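(* Let $G_0\in\mathcal{P}_1(\Theta)$. Then for every neighborhood $V$ of $G_0$ in the weak topology on $\mathcal{P}(\Theta)$ there exist a probability measure $G$ on $\Theta$ with finite first moment and $n\in\mathbb{N}$ such that the level $n$ SBA approximation $G^{(n)}$ of $G$ belongs to $V$. Moreover, if $G_0\in\mathcal{P}_*(\Theta)$, one may take $G=G_0$, and in this case the sequence $(G_0^{(n)})_{n\in\mathbb{N}}$ converges to $G_0$ in the weak topology.
   Context: $\Theta\subseteq\mathbb{R}$ is either $\mathbb{R}$, a closed half-line, or a compact interval with nonempty interior. $\mathcal{P}(\Theta)$ is the set of Borel probability measures on $\Theta$ with the weak topology (convergence against bounded continuous functions); $\mathcal{P}_1(\Theta)$ those with finite first moment; $\mathcal{P}_*(\Theta)$ those whose support is a non-degenerate compact interval. A measure $G$ is identified with its distribution function. For $a_1\le a_2$, $b_G(a_1,a_2]=\int_{(a_1,a_2]}\theta\,dG/(G(a_2)-G(a_1))$ if $G(a_2)>G(a_1)$ and $=a_1$ otherwise. The SBA of $G$ with finite mean: $\mu_{1,1}=\int\theta\,dG$; for $j\ge2$, $\mu_{j,2l}=\mu_{j-1,l}$ ($1\le l\le 2^{j-1}-1$), $\mu_{j,2l-1}=b_G(\mu_{j-1,l-1},\mu_{j-1,l}]$ ($1\le l\le 2^{j-1}$), with $\mu_{j,0}=\inf\Theta$, $\mu_{j,2^j}=\sup\Theta$. Level $n$ intervals: $\Theta_{n,1}=[\mu_{n,0},\mu_{n,1}]$ if $\mu_{n,0}>-\infty$, else $(\mu_{n,0},\mu_{n,1}]$;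 $\Theta_{n,l}=(\mu_{n,l-1},\mu_{n,l}]$ for $2\le l\le 2^n-1$; $\Theta_{n,2^n}=(\mu_{n,2^n-1},\mu_{n,2^n}]$ if $\mu_{n,2^n}<\infty$, else $(\mu_{n,2^n-1},\infty)$. The level $n$ SBA approximation is $G^{(n)}=\sum_{l=1}^{2^n}G(\Theta_{n,l})\delta_{\mu_{n+1,2l-1}}$. *)

theory Defs
  imports "HOL-Analysis.Analysis" "HOL-Probability.Probability"
begin

definition admissible_Theta :: "real set \<Rightarrow> bool" where
  "admissible_Theta T \<longleftrightarrow> T = UNIV \<or> (\<exists>a. T = {a..} \<or> T = {..a}) \<or> (\<exists>a b. a < b \<and> T = {a..b})"

definition prob_on :: "real set \<Rightarrow> real measure \<Rightarrow> bool" where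
  "prob_on T G \<longleftrightarrow> prob_space G \<and> sets G = sets borel \<and> emeasure G T = 1"

definition prob_on_1 :: "real set \<Rightarrow> real measure \<Rightarrow> bool" where
  "prob_on_1 T G \<longleftrightarrow> prob_on T G \<and> integrable G (\<lambda>x. x)"

definition msupport :: "real measure \<Rightarrow> real set" where
  "msupport G = {x. \<forall>e>0. emeasure G (ball x e) > 0}"

definition prob_on_star :: "real set \<Rightarrow> real measure \<Rightarrow> bool" where
  "prob_on_star T G \<longleftrightarrow> prob_on T G \<and> (\<exists>a b. a < b \<and> msupport G = {a..b})"

definition weak_top :: "real set \<Rightarrow> real measure topology" where
  "weak_top T = topology_generated_by
     {{G. prob_on T G \<and> (LINT x:T|G. f x) \<in> W} | f W.
        continuous_on T (f :: real \<Rightarrow> real) \<and> bounded (f ` T) \<and> open (W :: real set)}"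

definition hoi :: "ereal \<Rightarrow> ereal \<Rightarrow> real set" where
  "hoi a1 a2 = {x. a1 < ereal x \<and> ereal x \<le> a2}"

text \<open>b_G(a1,a2]: conditional mean on (a1,a2] if it has positive mass, else a1.
(G(a2) > G(a1) for the distribution function G means exactly positive mass of (a1,a2].)\<close>
definition bG :: "real measure \<Rightarrow> ereal \<Rightarrow> ereal \<Rightarrow> ereal" where
  "bG G a1 a2 = (if measure G (hoi a1 a2) > 0
      then ereal ((LINT x:hoi a1 a2|G. x) / measure G (hoi a1 a2)) else a1)"

text \<open>The SBA points mu_{j,l}. Level 0 (mu_{0,0} = inf T, mu_{0,1} = sup T) is an
auxiliary convention; the paper's recursion starts at level 1.\<close>
fun sba :: "real set \<Rightarrow> real measure \<Rightarrow> nat \<Rightarrow> nat \<Rightarrow> ereal" where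
  "sba T G 0 l = (if l = 0 then Inf (ereal ` T) else Sup (ereal ` T))"
| "sba T G (Suc 0) l = (if l = 0 then Inf (ereal ` T) else if l = 1 then ereal (\<integral>x. x \<partial>G)
      else Sup (ereal ` T))"
| "sba T G (Suc (Suc j)) l = (if l = 0 then Inf (ereal ` T)
      else if l = 2 ^ (Suc (Suc j)) then Sup (ereal ` T)
      else if even l then sba T G (Suc j) (l div 2)
      else bG G (sba T G (Suc j) (l div 2)) (sba T G (Suc j) (l div 2 + 1)))"

text \<open>Level n intervals Theta_{n,l}, 1 \<le> l \<le> 2^n.  The first one includes its left
endpoint when that is finite; the last one is (mu, \<infinity>) when sup T = \<infinity>.\<close>
definition sba_int :: "real set \<Rightarrow> real measure \<Rightarrow> nat \<Rightarrow> nat \<Rightarrow> real set" where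
  "sba_int T G n l = {x. (if l = 1 then sba T G n 0 \<le> ereal x else sba T G n (l - 1) < ereal x)
      \<and> ereal x \<le> sba T G n l}"

definition sba_approx :: "real set \<Rightarrow> real measure \<Rightarrow> nat \<Rightarrow> real measure" where
  "sba_approx T G n = measure_of UNIV (sets borel)
     (\<lambda>A. \<Sum>l\<in>{1..2^n}. emeasure G (sba_int T G n l)
              * indicator A (real_of_ereal (sba T G (Suc n) (2 * l - 1))))"

end

theory Submission
  imports Defs "HOL-Real_Asymp.Real_Asymp"
begin

text \<open>
  The level \<open>n\<close> SBA approximation is the image of \<open>G\<close> under the step function sending each level \<open>n\<close>
  interval to the SBA point inside it. If the support of \<open>G\<close> is a nondegenerate compact interval, the
  step functions converge almost surely to the identity: the nested intervals containing a support
  point \<open>x\<close> shrink to an interval from \<open>L\<close> to \<open>R\<close>; if its interior had positive mass, the conditional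
  means, each of which is an endpoint of the next interval, would converge to a point strictly
  between \<open>L\<close> and \<open>R\<close>, which is absurd. Hence this limit interval meets the support only in \<open>x\<close>,
  and the step functions, whose values are in the support too, are squeezed to \<open>x\<close>. Dominated convergence then
  gives weak convergence. For general \<open>G0\<close> it suffices that such measures are weakly dense, which is
  seen by clamping a \<open>G0\<close>-distributed variable to a large compact interval and mixing in a small
  uniform part.
\<close>

section \<open>The weak topology and its convergent sequences\<close>

lemma topspace_weak_top: "topspace (weak_top T) = {G. prob_on T G}"
proof -
  \<comment> \<open>The zero function with \<open>W = UNIV\<close> imposes no condition, so the set
    of all probability measures on \<open>T\<close> is itself subbasic.\<close>
  have "bounded ((\<lambda>_. 0 :: real) ` T)" by (rule bounded_subset[of "{0}"]) auto
  then have "{G. prob_on T G} \<in> {{G. prob_on T G \<and> (LINT x:T|G. f x) \<in> W} | f W.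
      continuous_on T (f :: real \<Rightarrow> real) \<and> bounded (f ` T) \<and> open (W :: real set)}"
    by (intro CollectI exI[of _ "\<lambda>_. 0"] exI[of _ UNIV]) auto
  then have "G \<in> topspace (weak_top T)" if "prob_on T G" for G
    unfolding weak_top_def topology_generated_by_topspace using that by blast
  then show ?thesis
    unfolding weak_top_def by auto
qed

text \<open>Eventual membership survives finite intersections and arbitrary unions, so by induction
  over the generated open sets only the subbasic ones have to be checked; there it is convergence of
  the integrals.\<close>

lemma limitin_weak_top:
  assumes G: "prob_on T G" and H: "\<And>n. prob_on T (H n)"
    and lim: "\<And>f :: real \<Rightarrow> real. continuous_on T f \<Longrightarrow> bounded (f ` T) \<Longrightarrow>
      (\<lambda>n. LINT x:T|H n. f x) \<longlonglongrightarrow> (LINT x:T|G. f x)"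
  shows "limitin (weak_top T) H G sequentially"
proof -
  have "eventually (\<lambda>n. H n \<in> U) sequentially" if "openin (weak_top T) U" "G \<in> U" for U
    using that(1)[unfolded weak_top_def, THEN openin_topology_generated_by] that(2)
  proof induction
    case (Basis S)
    from Basis(1) show ?case
    proof (elim CollectE exE conjE)
      fix f :: "real \<Rightarrow> real" and W :: "real set" assume S: "S = {G. prob_on T G \<and> (LINT x:T|G. f x) \<in> W}"
        and f: "continuous_on T f" "bounded (f ` T)" and W: "open W"
      have "(LINT x:T|G. f x) \<in> W" using Basis(2) by (simp add: S)
      from topological_tendstoD[OF lim[OF f] W this] H show ?case
        by (simp add: S)
    qed
  next
    case (Int U V)
    then show ?case by (simp add: eventually_conj_iff)
  next
    case (UN K)
    then obtain k where "k \<in> K" "eventually (\<lambda>n. H n \<in> k) sequentially" by blast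
    then show ?case by (auto elim: eventually_mono)
  qed simp
  then show ?thesis
    using G by (simp add: limitin_def topspace_weak_top)
qed

section \<open>The support of a measure and conditional means\<close>

text \<open>The complement of the support is a union of open null balls; by the Lindelof property
  countably many of them already cover it.\<close>

lemma AE_msupport:
  assumes sets: "sets G = sets borel"
  shows "AE x in G. x \<in> msupport G"
proof -
  define \<F> where "\<F> = {ball x e | x e. e > 0 \<and> emeasure G (ball x e) = 0}"
  obtain \<F>' where \<F>': "\<F>' \<subseteq> \<F>" "countable \<F>'" "\<Union>\<F>' = \<Union>\<F>"
    by (rule Lindelof[of \<F>]) (auto simp: \<F>_def)
  have "B \<in> null_sets G" if "B \<in> \<F>'" for B
  proof -
    have "B \<in> \<F>" using that \<F>'(1) by blast
    then show ?thesis by (auto simp: \<F>_def sets null_sets_def)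
  qed
  with \<F>'(2) have "(\<Union>B\<in>\<F>'. B) \<in> null_sets G" by (rule null_sets_UN')
  moreover have "{x \<in> space G. x \<notin> msupport G} \<subseteq> (\<Union>B\<in>\<F>'. B)"
  proof clarify
    fix x assume "x \<notin> msupport G"
    then obtain e where "e > 0" "emeasure G (ball x e) = 0"
      by (auto simp: msupport_def zero_less_iff_neq_zero)
    then have "ball x e \<in> \<F>" "x \<in> ball x e" by (auto simp: \<F>_def)
    then have "x \<in> \<Union>\<F>" by blast
    then show "x \<in> (\<Union>B\<in>\<F>'. B)" using \<F>'(3) by simp
  qed
  ultimately show ?thesis by (rule AE_I')
qed

lemma closed_admissible_Theta: "admissible_Theta T \<Longrightarrow> closed T"
  by (auto simp: admissible_Theta_def)

locale interval_supported = prob_space G for G :: "real measure" +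
  fixes T :: "real set" and a b :: real
  assumes sets_G [measurable_cong]: "sets G = sets borel"
    and supp: "msupport G = {a..b}" and ab: "a < b"
    and closed_T: "closed T" and T1: "emeasure G T = 1"
begin

lemma space_G [simp]: "space G = UNIV"
  using sets_eq_imp_space_eq[OF sets_G] by simp

lemma AE_supp: "AE x in G. x \<in> {a..b}"
  using AE_msupport[OF sets_G] by (simp add: supp)

lemma T_measurable [measurable]: "T \<in> sets borel"
  using closed_T by (rule borel_closed)

lemma AE_T: "AE x in G. x \<in> T"
proof -
  have "prob T = 1" using T1 by (simp add: measure_def)
  then show ?thesis by (subst prob_eq_1[symmetric]) (auto simp: sets_G T_measurable)
qed

text \<open>Since \<open>T\<close> is closed and carries all the mass, a point outside it has a null
  ball around it and cannot be a support point.\<close>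

lemma supp_subset_T: "{a..b} \<subseteq> T"
proof
  fix x assume x: "x \<in> {a..b}"
  show "x \<in> T"
  proof (rule ccontr)
    assume "x \<notin> T"
    then obtain e where e: "e > 0" "ball x e \<subseteq> - T"
      using closed_T by (meson ComplI open_Compl open_contains_ball)
    then have "AE y in G. y \<notin> ball x e" using AE_T by (auto elim!: eventually_mono)
    then have "emeasure G (ball x e) = 0"
      by (subst (asm) AE_iff_measurable[where N="ball x e"]) (auto simp: sets_G)
    with x e show False unfolding supp[symmetric] msupport_def by auto
  qed
qed

lemma Inf_T_le: "Inf (ereal ` T) \<le> ereal a" and Sup_T_ge: "ereal b \<le> Sup (ereal ` T)"
proof -
  have "a \<in> T" "b \<in> T" using supp_subset_T ab by auto
  then show "Inf (ereal ` T) \<le> ereal a" "ereal b \<le> Sup (ereal ` T)"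
    by (auto intro!: Inf_lower Sup_upper)
qed

lemma emeasure_open_interval:
  assumes "c < d" "c < b" "a < d"
  shows "emeasure G {c<..<d} > 0"
proof -
  \<comment> \<open>The midpoint of the overlap of \<open>{c<..<d}\<close> and
    \<open>{a..b}\<close>: a support point interior to \<open>{c<..<d}\<close>.\<close>
  define x where "x = (max c a + min d b) / 2"
  have x: "c < x" "x < d" "x \<in> {a..b}"
    using assms ab by (auto simp: x_def)
  define e where "e = min (x - c) (d - x)"
  have "0 < emeasure G (ball x e)"
    using x unfolding supp[symmetric] msupport_def by (auto simp: e_def)
  also have "\<dots> \<le> emeasure G {c<..<d}"
    by (intro emeasure_mono) (auto simp: e_def dist_real_def sets_G)
  finally show ?thesis .
qed

lemma integrable_id: "integrable G (\<lambda>x. x)"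
proof (rule integrable_const_bound)
  show "AE x in G. norm x \<le> max \<bar>a\<bar> \<bar>b\<bar>"
    using AE_supp by eventually_elim auto
qed measurable

text \<open>Real-valued and defined for arbitrary sets, because \<open>bG\<close> only handles
  half-open intervals, while limits of conditional means lead to intersections of such
  intervals.\<close>

definition cmean :: "real set \<Rightarrow> real" where
  "cmean S = (LINT x:S|G. x) / measure G S"

text \<open>\<open>S\<close> is sandwiched between the open and the closed interval from
  \<open>L\<close> to \<open>R\<close>, so that half-open intervals, the whole line and
  intersections of nested intervals are all covered. The bounds are strict because the open part has
  positive mass, and on it the identity differs from either bound.\<close>

lemma
  fixes L R :: ereal
  assumes LR: "L < R" "L < b" "a < R"
    and S [measurable]: "S \<in> sets borel"
    and sub: "\<And>x. L < ereal x \<Longrightarrow> ereal x < R \<Longrightarrow> x \<in> S"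
    and sup: "\<And>x. x \<in> S \<Longrightarrow> L \<le> ereal x \<and> ereal x \<le> R"
  shows measure_between_pos: "measure G S > 0"
    and cmean_gt: "max L a < cmean S" and cmean_less: "cmean S < min R b"
proof -
  \<comment> \<open>Cutting \<open>L\<close> and \<open>R\<close> down to the support makes both
    endpoints finite without losing any mass.\<close>
  define c where "c = real_of_ereal (max L a)"
  define d where "d = real_of_ereal (min R b)"
  have c: "ereal c = max L a" and d: "ereal d = min R b"
    using LR unfolding c_def d_def by (cases L; cases R; auto simp: max_def min_def)+
  have "ereal c < ereal d" "ereal c < b" "ereal a < d"
    unfolding c d using LR ab by auto
  then have cd: "c < d" "c < b" "a < d" by auto
  have cdS: "{c<..<d} \<subseteq> S"
  proof
    fix x assume "x \<in> {c<..<d}"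
    then have "max L a < ereal x" "ereal x < min R b"
      unfolding c[symmetric] d[symmetric] by auto
    then show "x \<in> S" by (auto intro: sub)
  qed
  have bounds: "AE x in G. x \<in> S \<longrightarrow> c \<le> x \<and> x \<le> d"
    using AE_supp
  proof eventually_elim
    case (elim x)
    then have "x \<in> S \<Longrightarrow> ereal c \<le> x \<and> ereal x \<le> d"
      unfolding c d using sup[of x] by auto
    then show ?case by auto
  qed
  have pos: "emeasure G {c<..<d} > 0" using cd by (rule emeasure_open_interval)
  also have "emeasure G {c<..<d} \<le> emeasure G S" using cdS by (intro emeasure_mono) (auto simp: sets_G)
  finally show mS: "measure G S > 0" by (simp add: emeasure_eq_measure)
  have int: "integrable G (\<lambda>x. indicator S x *\<^sub>R k)" "integrable G (\<lambda>x. indicator S x *\<^sub>R x)" for k :: real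
    using integrable_id by (intro integrable_mult_indicator; simp add: sets_G)+
  have "(\<integral>x. indicator S x *\<^sub>R c \<partial>G) < (\<integral>x. indicator S x *\<^sub>R x \<partial>G)"
    using bounds pos cdS
    by (intro integral_less_AE[where A="{c<..<d}"] int) (auto simp: sets_G indicator_def elim!: eventually_mono)
  then have "c < cmean S"
    using mS by (simp add: cmean_def set_lebesgue_integral_def field_simps)
  then show "max L a < cmean S" by (simp flip: c)
  have "(\<integral>x. indicator S x *\<^sub>R x \<partial>G) < (\<integral>x. indicator S x *\<^sub>R d \<partial>G)"
    using bounds pos cdS
    by (intro integral_less_AE[where A="{c<..<d}"] int) (auto simp: sets_G indicator_def elim!: eventually_mono)
  then have "cmean S < d"
    using mS by (simp add: cmean_def set_lebesgue_integral_def field_simps)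
  then show "cmean S < min R b" by (simp flip: d)
qed

lemma hoi_measurable [measurable]: "hoi L R \<in> sets borel"
  unfolding hoi_def by measurable

lemma bG_eq_cmean:
  fixes L R :: ereal
  assumes "L < R" "L < b" "a < R"
  shows "bG G L R = ereal (cmean (hoi L R))"
proof -
  have "measure G (hoi L R) > 0"
    by (rule measure_between_pos[OF assms hoi_measurable]) (auto simp: hoi_def)
  then show ?thesis by (simp add: bG_def cmean_def)
qed

lemma bG_between:
  fixes L R :: ereal
  assumes "L < R" "L < b" "a < R"
  shows "max L a < bG G L R \<and> bG G L R < min R b"
proof -
  have "max L a < cmean (hoi L R)"
    by (rule cmean_gt[OF assms hoi_measurable]) (auto simp: hoi_def)
  moreover have "cmean (hoi L R) < min R b"
    by (rule cmean_less[OF assms hoi_measurable]) (auto simp: hoi_def)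
  ultimately show ?thesis using bG_eq_cmean[OF assms] by simp
qed

section \<open>Interlacing of the SBA points\<close>

lemma sba_0: "sba T G n 0 = Inf (ereal ` T)"
  by (cases "(T, G, n, 0::nat)" rule: sba.cases) auto

lemma sba_top: "sba T G n (2 ^ n) = Sup (ereal ` T)"
  by (cases "(T, G, n, 2 ^ n::nat)" rule: sba.cases) auto

lemma sba_even:
  assumes "l \<le> 2 ^ n"
  shows "sba T G (Suc n) (2 * l) = sba T G n l"
proof (cases n)
  case (Suc m)
  then show ?thesis using assms by (cases "l = 2 ^ n") (auto simp: sba_0 sba_top[of "Suc m", simplified])
qed (use assms in auto)

text \<open>An odd index is neither \<open>0\<close> nor a positive power-of-two bound, so the
  boundary branches are never taken. The level is \<open>Suc (Suc n)\<close> because the recursion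
  through \<open>bG\<close> starts only there.\<close>

lemma sba_odd:
  assumes "1 \<le> l" "l \<le> 2 ^ Suc n"
  shows "sba T G (Suc (Suc n)) (2 * l - 1) = bG G (sba T G (Suc n) (l - 1)) (sba T G (Suc n) l)"
proof -
  have "odd (2 * l - 1)" "(2 * l - 1) div 2 = l - 1" "l - 1 + 1 = l" "2 * l - 1 \<noteq> 0"
    using assms by presburger+
  moreover from this(1) have "2 * l - 1 \<noteq> 2 ^ Suc (Suc n)" by (metis even_power even_numeral zero_less_Suc)
  ultimately show ?thesis by (simp only: sba.simps(3) if_False)
qed

lemma mean_between: "max (Inf (ereal ` T)) a < sba T G 1 1 \<and> sba T G 1 1 < min (Sup (ereal ` T)) b"
proof -
  \<comment> \<open>The mean is the conditional mean on the whole line, viewed as the interval from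
    minus infinity to infinity.\<close>
  have 1: "max (-\<infinity>) (ereal a) < cmean UNIV"
    by (rule cmean_gt[of _ \<infinity>]) simp_all
  have 2: "cmean UNIV < min \<infinity> (ereal b)"
    by (rule cmean_less[of "-\<infinity>"]) simp_all
  have "cmean UNIV = (\<integral>x. x \<partial>G)"
    using prob_space by (simp add: cmean_def set_lebesgue_integral_def)
  with 1 2 show ?thesis
    using order.strict_trans1[OF Inf_T_le] order.strict_trans2[OF _ Sup_T_ge] by simp
qed

text \<open>Each new point is a conditional mean over an interval of positive mass, which lies
  strictly inside that interval and strictly between \<open>a\<close> and \<open>b\<close>.\<close>

lemma sba_odd_between:
  assumes "1 \<le> l" "l \<le> 2 ^ n"
  shows "max (sba T G n (l - 1)) a < sba T G (Suc n) (2 * l - 1) \<and>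
      sba T G (Suc n) (2 * l - 1) < min (sba T G n l) b"
proof -
  \<comment> \<open>The induction also carries that every level \<open>n\<close> interval is
    nondegenerate and overlaps the interior of the support; this is what keeps \<open>bG\<close> out
    of its default branch.\<close>
  have "(sba T G n (l - 1) < sba T G n l \<and> sba T G n (l - 1) < b \<and> a < sba T G n l) \<and>
    max (sba T G n (l - 1)) a < sba T G (Suc n) (2 * l - 1) \<and>
      sba T G (Suc n) (2 * l - 1) < min (sba T G n l) b"
    using assms
  proof (induction n arbitrary: l)
    case 0
    then have "l = 1" by simp
    moreover have "Inf (ereal ` T) < ereal b" "ereal a < Sup (ereal ` T)"
      using order.strict_trans1[OF Inf_T_le, of b] order.strict_trans2[OF _ Sup_T_ge, of a] ab by auto
    moreover from mean_between have "Inf (ereal ` T) < Sup (ereal ` T)"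
      by (metis max_less_iff_conj min_less_iff_conj less_trans)
    ultimately show ?case using mean_between by simp
  next
    case (Suc n)
    \<comment> \<open>The index of the parent interval, which is cut into the intervals
      \<open>2 * k - 1\<close> and \<open>2 * k\<close>.\<close>
    define k where "k = (l + 1) div 2"
    have k: "1 \<le> k" "k \<le> 2 ^ n" using Suc.prems by (auto simp: k_def)
    note IH = Suc.IH[OF k]
    have e: "sba T G (Suc n) (2 * k) = sba T G n k" "sba T G (Suc n) (2 * (k - 1)) = sba T G n (k - 1)"
      using k by (intro sba_even; simp)+
    consider "l = 2 * k" | "l = 2 * k - 1" using Suc.prems(1) unfolding k_def by linarith
    then have 1: "sba T G (Suc n) (l - 1) < sba T G (Suc n) l \<and> sba T G (Suc n) (l - 1) < b \<and> a < sba T G (Suc n) l"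
    proof cases
      case 1
      then show ?thesis using IH e by auto
    next
      case 2
      then have "l - 1 = 2 * (k - 1)" by auto
      then show ?thesis using IH e 2 by auto
    qed
    with bG_between[of "sba T G (Suc n) (l - 1)" "sba T G (Suc n) l"] show ?case
      unfolding sba_odd[OF Suc.prems] by auto
  qed
  then show ?thesis by blast
qed

section \<open>The SBA step functions\<close>

text \<open>The interval containing \<open>x\<close> is found by bisection, comparing
  \<open>x\<close> with the SBA point inside the current interval. Points outside \<open>T\<close>
  get an index as well, so the level sets partition the whole line.\<close>

primrec sba_idx :: "nat \<Rightarrow> real \<Rightarrow> nat" where
  "sba_idx 0 x = 1"
| "sba_idx (Suc n) x = (if ereal x \<le> sba T G (Suc n) (2 * sba_idx n x - 1)
    then 2 * sba_idx n x - 1 else 2 * sba_idx n x)"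

lemma sba_idx_range: "1 \<le> sba_idx n x" "sba_idx n x \<le> 2 ^ n"
proof -
  have "1 \<le> sba_idx n x \<and> sba_idx n x \<le> 2 ^ n" by (induction n) auto
  then show "1 \<le> sba_idx n x" "sba_idx n x \<le> 2 ^ n" by auto
qed

lemma sba_idx_measurable [measurable]: "sba_idx n \<in> borel \<rightarrow>\<^sub>M count_space UNIV"
proof (induction n)
  case (Suc n)
  have *: "sba_idx (Suc n) = (\<lambda>x. if ereal x \<le> sba T G (Suc n) (2 * sba_idx n x - 1)
    then 2 * sba_idx n x - 1 else 2 * sba_idx n x)" by (auto simp: fun_eq_iff)
  note [measurable] = Suc
  show ?case unfolding * by measurable
qed simp

text \<open>Induction along the bisection: the new point lies strictly inside the parent interval
  and splits it into its two children. Membership in \<open>T\<close> settles level zero.\<close>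

lemma mem_sba_int_iff:
  assumes "x \<in> T" "1 \<le> l" "l \<le> 2 ^ n"
  shows "x \<in> sba_int T G n l \<longleftrightarrow> sba_idx n x = l"
  using assms(2,3)
proof (induction n arbitrary: l)
  case 0
  moreover have "Inf (ereal ` T) \<le> ereal x" "ereal x \<le> Sup (ereal ` T)"
    using assms(1) by (auto intro: Inf_lower Sup_upper)
  ultimately show ?case by (auto simp: sba_int_def)
next
  case (Suc n)
  define k where "k = (l + 1) div 2"
  have k: "1 \<le> k" "k \<le> 2 ^ n" using Suc.prems by (auto simp: k_def)
  note IH = Suc.IH[OF k]
  have e: "sba T G (Suc n) (2 * k) = sba T G n k" "sba T G (Suc n) (2 * (k - 1)) = sba T G n (k - 1)"
    using k by (intro sba_even; simp)+
  have LMR: "sba T G n (k - 1) < sba T G (Suc n) (2 * k - 1)" "sba T G (Suc n) (2 * k - 1) < sba T G n k"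
    using sba_odd_between[OF k] by auto
  have i: "1 \<le> sba_idx n x" by (rule sba_idx_range)
  consider "l = 2 * k" | "l = 2 * k - 1" using Suc.prems(1) unfolding k_def by linarith
  then show ?case
  proof cases
    case 1
    have "sba_idx (Suc n) x = l \<longleftrightarrow> sba_idx n x = k \<and> sba T G (Suc n) (2 * k - 1) < ereal x"
      using i 1 by (auto simp: not_le) presburger+
    also have "\<dots> \<longleftrightarrow> sba T G (Suc n) (2 * k - 1) < ereal x \<and> ereal x \<le> sba T G n k"
      unfolding IH[symmetric] sba_int_def using LMR by auto
    also have "\<dots> \<longleftrightarrow> x \<in> sba_int T G (Suc n) l"
      using 1 k e by (simp add: sba_int_def)
    finally show ?thesis by simp
  next
    case 2
    have "sba_idx (Suc n) x = l \<longleftrightarrow> sba_idx n x = k \<and> ereal x \<le> sba T G (Suc n) (2 * k - 1)"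
      using i 2 k by (auto simp: not_le) presburger+
    also have "\<dots> \<longleftrightarrow> (if k = 1 then sba T G n 0 \<le> ereal x else sba T G n (k - 1) < ereal x) \<and>
        ereal x \<le> sba T G (Suc n) (2 * k - 1)"
      unfolding IH[symmetric] sba_int_def using LMR by auto
    also have "\<dots> \<longleftrightarrow> x \<in> sba_int T G (Suc n) l"
    proof -
      \<comment> \<open>A left child is the first interval exactly if its parent is, so a closed
        left end is inherited correctly.\<close>
      have "l - 1 = 2 * (k - 1)" "l = 1 \<longleftrightarrow> k = 1" using 2 k by auto
      then show ?thesis using 2 e by (simp add: sba_int_def sba_0)
    qed
    finally show ?thesis by simp
  qed
qed

definition sba_step :: "nat \<Rightarrow> real \<Rightarrow> real" where
  "sba_step n x = real_of_ereal (sba T G (Suc n) (2 * sba_idx n x - 1))"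

lemma sba_step_measurable [measurable]: "sba_step n \<in> borel_measurable borel"
  unfolding sba_step_def by measurable

text \<open>The strict bounds from interlacing force the SBA point to be finite, so
  \<open>real_of_ereal\<close> loses nothing in \<open>sba_step\<close>.\<close>

lemma sba_step_between:
  shows "max (sba T G n (sba_idx n x - 1)) a < sba_step n x"
    and "sba_step n x < min (sba T G n (sba_idx n x)) b"
    and ereal_sba_step: "ereal (sba_step n x) = sba T G (Suc n) (2 * sba_idx n x - 1)"
proof -
  note * = sba_odd_between[OF sba_idx_range, of n x]
  then show **: "ereal (sba_step n x) = sba T G (Suc n) (2 * sba_idx n x - 1)"
    unfolding sba_step_def by (cases "sba T G (Suc n) (2 * sba_idx n x - 1)") auto
  show "max (sba T G n (sba_idx n x - 1)) a < sba_step n x"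
    "sba_step n x < min (sba T G n (sba_idx n x)) b"
    unfolding ** using * by auto
qed

lemma sba_step_in_T: "sba_step n x \<in> T"
  using sba_step_between(1,2)[of n x] supp_subset_T by auto

section \<open>Pointwise convergence of the step functions\<close>

text \<open>Continuity from above handles the denominator and dominated convergence the numerator;
  positive limit mass permits the quotient.\<close>

lemma cmean_tendsto:
  assumes [measurable]: "\<And>n. A n \<in> sets borel" and dec: "decseq A" and pos: "measure G (\<Inter>n. A n) > 0"
  shows "(\<lambda>n. cmean (A n)) \<longlonglongrightarrow> cmean (\<Inter>n. A n)"
  unfolding cmean_def set_lebesgue_integral_def
proof (intro tendsto_divide)
  show "(\<lambda>n. measure G (A n)) \<longlonglongrightarrow> measure G (\<Inter>n. A n)"
    using dec by (intro finite_Lim_measure_decseq) (auto simp: sets_G)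
  show "(\<lambda>n. \<integral>x. indicator (A n) x *\<^sub>R x \<partial>G) \<longlonglongrightarrow> (\<integral>x. indicator (\<Inter>n. A n) x *\<^sub>R x \<partial>G)"
  proof (rule integral_dominated_convergence)
    show "integrable G (\<lambda>x. \<bar>x\<bar>)" using integrable_id by (rule integrable_abs)
    show "AE x in G. (\<lambda>n. indicator (A n) x *\<^sub>R x) \<longlonglongrightarrow> indicator (\<Inter>n. A n) x *\<^sub>R x"
      using dec by (intro AE_I2 tendsto_scaleR LIMSEQ_indicator_decseq tendsto_const)
    show "AE x in G. norm (indicator (A n) x *\<^sub>R x) \<le> \<bar>x\<bar>" for n
      by (auto simp: indicator_def)
  qed measurable
qed (use pos in auto)

lemma sba_step_tendsto:
  assumes x: "x \<in> {a..b}"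
  shows "(\<lambda>n. sba_step n x) \<longlonglongrightarrow> x"
proof -
  have xT: "x \<in> T" using x supp_subset_T by auto
  define L where "L n = sba T G n (sba_idx n x - 1)" for n
  define R where "R n = sba T G n (sba_idx n x)" for n
  define M where "M n = ereal (sba_step n x)" for n
  have M: "max (L n) a < M n" "M n < min (R n) b" for n
    unfolding L_def R_def M_def by (rule sba_step_between)+
  have xLR: "L n \<le> x \<and> x \<le> R n" for n
  proof -
    have "x \<in> sba_int T G n (sba_idx n x)"
      using mem_sba_int_iff[OF xT sba_idx_range] by simp
    then show ?thesis by (auto simp: sba_int_def L_def R_def split: if_splits)
  qed
  \<comment> \<open>One bisection: \<open>M n\<close> replaces whichever endpoint leaves
    \<open>x\<close> inside.\<close>
  have step: "(if ereal x \<le> M n then L (Suc n) = L n \<and> R (Suc n) = M n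
      else L (Suc n) = M n \<and> R (Suc n) = R n)" for n
  proof -
    define k where "k = sba_idx n x"
    have k: "1 \<le> k" "k \<le> 2 ^ n" using sba_idx_range by (auto simp: k_def)
    have "sba T G (Suc n) (2 * k) = sba T G n k" "sba T G (Suc n) (2 * (k - 1)) = sba T G n (k - 1)"
      using k by (intro sba_even; simp)+
    moreover have "2 * k - 1 - 1 = 2 * (k - 1)" by auto
    ultimately show ?thesis
      unfolding L_def R_def M_def ereal_sba_step sba_idx.simps k_def[symmetric] by simp
  qed
  have inc: "incseq L" and dec: "decseq R"
    using step M by (auto intro!: incseq_SucI decseq_SucI split: if_splits simp: less_imp_le)
      (metis less_imp_le max_less_iff_conj min_less_iff_conj order_refl)+
  define LL where "LL = (SUP n. L n)"
  define RR where "RR = (INF n. R n)"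
  have LL: "L n \<le> LL" and RR: "RR \<le> R n" for n
    unfolding LL_def RR_def by (auto intro: SUP_upper INF_lower)
  have xLLRR: "LL \<le> x" "x \<le> RR"
    unfolding LL_def RR_def using xLR by (auto intro: SUP_least INF_greatest)
  have "\<not> max LL a < min RR b"
  proof
    assume less: "max LL a < min RR b"
    then have less': "LL < RR" "LL < b" "a < RR" by auto
    \<comment> \<open>Shifted by one level, since points are obtained from \<open>bG\<close> only
      over intervals of level at least one.\<close>
    define A where "A n = hoi (L (Suc n)) (R (Suc n))" for n
    have A [measurable]: "A n \<in> sets borel" for n unfolding A_def by (rule hoi_measurable)
    have iA: "(\<Inter>n. A n) \<in> sets borel" by measurable
    \<comment> \<open>Whether \<open>LL\<close> and \<open>RR\<close> belong to the intersection is
      left open; the sandwich between the open and the closed interval is enough.\<close>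
    have sub: "x \<in> (\<Inter>n. A n)" if "LL < ereal x" "ereal x < RR" for x
      using that LL RR unfolding A_def hoi_def by (auto intro: le_less_trans less_le_trans less_imp_le)
    have sup: "LL \<le> ereal x \<and> ereal x \<le> RR" if "x \<in> (\<Inter>n. A n)" for x
    proof -
      have "L n \<le> ereal x \<and> ereal x \<le> R n" for n
        using that incseqD[OF inc, of n "Suc n"] decseqD[OF dec, of n "Suc n"] 
        by (auto simp: A_def hoi_def dest!: spec[of _ n])
      then show ?thesis unfolding LL_def RR_def by (auto intro: SUP_least INF_greatest)
    qed
    have decA: "decseq A"
    proof (rule decseq_SucI)
      fix n
      have "L (Suc n) \<le> L (Suc (Suc n))" "R (Suc (Suc n)) \<le> R (Suc n)"
        using inc dec by (auto simp: incseq_Suc_iff decseq_Suc_iff)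
      then show "A (Suc n) \<subseteq> A n" by (auto simp: A_def hoi_def)
    qed
    have lim: "(\<lambda>n. cmean (A n)) \<longlonglongrightarrow> cmean (\<Inter>n. A n)"
      by (rule cmean_tendsto[OF A decA measure_between_pos[OF less' iA sub sup]])
    have M_cmean: "M (Suc n) = cmean (A n)" for n
    proof -
      have "M (Suc n) = bG G (L (Suc n)) (R (Suc n))"
        unfolding M_def L_def R_def ereal_sba_step by (rule sba_odd[OF sba_idx_range])
      also have "\<dots> = cmean (A n)"
        using M[of "Suc n"] ab unfolding A_def
        by (intro bG_eq_cmean) (auto intro: less_trans)
      finally show ?thesis .
    qed
    have "LL < cmean (\<Inter>n. A n)" "cmean (\<Inter>n. A n) < RR"
      using cmean_gt[OF less' iA sub sup] cmean_less[OF less' iA sub sup] by auto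
    then have "\<forall>\<^sub>F n in sequentially. LL < M (Suc n) \<and> M (Suc n) < RR"
      unfolding M_cmean
      by (intro eventually_conj order_tendstoD[OF tendsto_ereal[OF lim]])
    then obtain n where n: "LL < M (Suc n)" "M (Suc n) < RR"
      by (auto dest: eventually_happens)
    \<comment> \<open>As an endpoint of the next interval, \<open>M (Suc n)\<close> is at most
      \<open>LL\<close> or at least \<open>RR\<close>, so it cannot lie strictly between
      them.\<close>
    have "M (Suc n) = R (Suc (Suc n)) \<or> M (Suc n) = L (Suc (Suc n))"
      using step[of "Suc n"] by presburger
    then show False using n LL[of "Suc (Suc n)"] RR[of "Suc (Suc n)"] by auto
  qed
  then have "min RR b \<le> max LL a" by (rule leI)
  moreover have "max LL a \<le> x" "x \<le> min RR b" using xLLRR x by simp_all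
  ultimately have eq: "max LL a = x" "min RR b = x"
    by (meson antisym order_trans)+
  \<comment> \<open>The endpoints themselves need not tend to \<open>x\<close>, for instance where
    the intervals reach beyond the support; clamped to \<open>a\<close> and \<open>b\<close> they
    do.\<close>
  have "M \<longlonglongrightarrow> ereal x"
  proof (rule tendsto_sandwich)
    show "(\<lambda>n. max (L n) a) \<longlonglongrightarrow> ereal x"
      unfolding eq(1)[symmetric] LL_def by (intro tendsto_max LIMSEQ_SUP inc tendsto_const)
    show "(\<lambda>n. min (R n) b) \<longlonglongrightarrow> ereal x"
      unfolding eq(2)[symmetric] RR_def by (intro tendsto_min LIMSEQ_INF dec tendsto_const)
  qed (use M in \<open>simp_all add: less_imp_le\<close>)
  then show ?thesis unfolding M_def by simp
qed

section \<open>Approximations as image measures and almost sure convergence\<close>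

text \<open>The level sets of \<open>sba_idx n\<close> partition the line, agree with the level
  \<open>n\<close> intervals up to null sets, and \<open>sba_step n\<close> is constant on each.
  Both sides are \<open>measure_of\<close> over the same sigma-algebra, so equality of the set
  functions suffices.\<close>

lemma sba_approx_eq_distr: "sba_approx T G n = distr G borel (sba_step n)"
  unfolding sba_approx_def distr_def space_borel
proof (rule measure_of_eq)
  fix B :: "real set" assume "B \<in> sigma_sets UNIV (sets borel)"
  then have B [measurable]: "B \<in> sets borel"
    using sets.sigma_sets_eq[of "borel :: real measure"] by simp
  have eq: "emeasure G (sba_int T G n l) * indicator B (real_of_ereal (sba T G (Suc n) (2 * l - 1)))
      = emeasure G (sba_step n -` B \<inter> {x. sba_idx n x = l})" (is "?lhs = _")
    if l: "l \<in> {1..2 ^ n}" for l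
  proof -
    have "emeasure G (sba_int T G n l) = emeasure G {x. sba_idx n x = l}"
    proof (rule emeasure_eq_AE)
      show "AE x in G. x \<in> sba_int T G n l \<longleftrightarrow> x \<in> {x. sba_idx n x = l}"
        using AE_T by eventually_elim (use mem_sba_int_iff l in auto)
    qed (auto simp: sets_G sba_int_def)
    moreover have "sba_step n -` B \<inter> {x. sba_idx n x = l} = (if real_of_ereal (sba T G (Suc n) (2 * l - 1)) \<in> B
        then {x. sba_idx n x = l} else {})"
      by (auto simp: sba_step_def)
    ultimately show ?thesis by simp
  qed
  have "(\<Sum>l\<in>{1..2 ^ n}. emeasure G (sba_int T G n l) * indicator B (real_of_ereal (sba T G (Suc n) (2 * l - 1))))
      = (\<Sum>l\<in>{1..2 ^ n}. emeasure G (sba_step n -` B \<inter> {x. sba_idx n x = l}))"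
    by (intro sum.cong refl eq)
  also have "\<dots> = emeasure G (\<Union>l\<in>{1..2 ^ n}. sba_step n -` B \<inter> {x. sba_idx n x = l})"
    by (intro sum_emeasure) (auto simp: disjoint_family_on_def sets_G)
  also have "(\<Union>l\<in>{1..2 ^ n}. sba_step n -` B \<inter> {x. sba_idx n x = l}) = sba_step n -` B \<inter> space G"
    using sba_idx_range by auto
  finally show "(\<Sum>l\<in>{1..2 ^ n}. emeasure G (sba_int T G n l) * indicator B (real_of_ereal (sba T G (Suc n) (2 * l - 1))))
      = emeasure G (sba_step n -` B \<inter> space G)" .
qed simp

end

text \<open>Almost sure convergence implies weak convergence, by dominated convergence for a bounded
  continuous test function.\<close>

lemma limitin_weak_top_distr:
  assumes M: "prob_space M" and T: "closed T"
    and X [measurable]: "\<And>n. X n \<in> borel_measurable M" and Y [measurable]: "Y \<in> borel_measurable M"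
    and XT: "\<And>n \<omega>. X n \<omega> \<in> T" and YT: "AE \<omega> in M. Y \<omega> \<in> T"
    and lim: "AE \<omega> in M. (\<lambda>n. X n \<omega>) \<longlonglongrightarrow> Y \<omega>"
  shows "limitin (weak_top T) (\<lambda>n. distr M borel (X n)) (distr M borel Y) sequentially"
proof (rule limitin_weak_top)
  interpret prob_space M by (rule M)
  have [measurable]: "T \<in> sets borel" using T by (rule borel_closed)
  have prob_on: "prob_on T (distr M borel Z)"
    if [measurable]: "Z \<in> borel_measurable M" and Z: "AE \<omega> in M. Z \<omega> \<in> T" for Z
  proof -
    have "emeasure (distr M borel Z) T = emeasure M (Z -` T \<inter> space M)"
      by (rule emeasure_distr) measurable
    also have "\<dots> = 1"
      using Z by (intro emeasure_eq_1_AE) auto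
    finally show ?thesis unfolding prob_on_def by (auto intro: prob_space_distr)
  qed
  show "prob_on T (distr M borel Y)" using YT by (intro prob_on) auto
  show "prob_on T (distr M borel (X n))" for n using XT by (intro prob_on) auto
  fix f :: "real \<Rightarrow> real" assume f: "continuous_on T f" "bounded (f ` T)"
  \<comment> \<open>The test function is controlled only on \<open>T\<close>; extension by zero
    makes it measurable and bounded on the line.\<close>
  define g where "g x = indicator T x *\<^sub>R f x" for x
  have g [measurable]: "g \<in> borel_measurable borel"
    unfolding g_def using f(1) by (intro borel_measurable_continuous_on_indicator) auto
  obtain B where B: "\<And>x. x \<in> T \<Longrightarrow> \<bar>f x\<bar> \<le> B"
    using f(2) by (auto simp: bounded_iff)
  have "(\<lambda>n. \<integral>\<omega>. g (X n \<omega>) \<partial>M) \<longlonglongrightarrow> (\<integral>\<omega>. g (Y \<omega>) \<partial>M)"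
  proof (rule integral_dominated_convergence)
    show "AE \<omega> in M. (\<lambda>n. g (X n \<omega>)) \<longlonglongrightarrow> g (Y \<omega>)"
      using lim YT
    proof eventually_elim
      case (elim \<omega>)
      have "(\<lambda>n. f (X n \<omega>)) \<longlonglongrightarrow> f (Y \<omega>)"
        using continuous_on_tendsto_compose[OF f(1) elim] XT by simp
      then show ?case using XT elim(2) by (simp add: g_def)
    qed
    show "AE \<omega> in M. norm (g (X n \<omega>)) \<le> B" for n
      using B XT by (simp add: g_def)
  qed auto
  then show "(\<lambda>n. LINT x:T|distr M borel (X n). f x) \<longlonglongrightarrow> (LINT x:T|distr M borel Y. f x)"
    unfolding set_lebesgue_integral_def g_def[symmetric] by (simp add: integral_distr)
qed

lemma (in interval_supported) limitin_sba_approx: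
  "limitin (weak_top T) (\<lambda>n. sba_approx T G n) G sequentially"
proof -
  have "limitin (weak_top T) (\<lambda>n. distr G borel (sba_step n)) (distr G borel (\<lambda>x. x)) sequentially"
  proof (rule limitin_weak_top_distr)
    show "AE x in G. (\<lambda>n. sba_step n x) \<longlonglongrightarrow> x"
      using AE_supp by eventually_elim (rule sba_step_tendsto)
  qed (use AE_T closed_T sba_step_in_T in \<open>auto intro: prob_space_axioms\<close>)
  moreover have "distr G borel (\<lambda>x. x) = G" using sets_G by (intro distr_id2) simp
  ultimately show ?thesis by (simp add: sba_approx_eq_distr)
qed

lemma limitin_sba_approx_prob_on_star:
  assumes "admissible_Theta T" "prob_on_star T G"
  shows "limitin (weak_top T) (\<lambda>n. sba_approx T G n) G sequentially"
proof -
  from assms(2) obtain a b where "a < b" "msupport G = {a..b}" "prob_on T G"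
    by (auto simp: prob_on_star_def)
  then interpret interval_supported G T a b
    using closed_admissible_Theta[OF assms(1)]
    by (auto simp: interval_supported_def interval_supported_axioms_def prob_on_def)
  show ?thesis by (rule limitin_sba_approx)
qed

section \<open>Density of the measures supported on compact intervals\<close>

lemma admissible_Theta_exhaustion:
  assumes "admissible_Theta T"
  obtains \<alpha> \<beta> :: "nat \<Rightarrow> real" where "\<And>k. \<alpha> k < \<beta> k" "\<And>k. {\<alpha> k..\<beta> k} \<subseteq> T"
    "\<And>x. x \<in> T \<Longrightarrow> \<forall>\<^sub>F k in sequentially. x \<in> {\<alpha> k..\<beta> k}"
proof -
  have ev: "\<forall>\<^sub>F k in sequentially. r \<le> real k + 1" for r :: real
    by real_asymp
  from assms consider "T = UNIV" | a where "T = {a..}" | a where "T = {..a}"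
    | a b where "a < b" "T = {a..b}" by (auto simp: admissible_Theta_def)
  then show thesis
  proof cases
    case 1
    have "\<forall>\<^sub>F k in sequentially. x \<in> {- (real k + 1)..real k + 1}" for x
      using ev[of "- x"] ev[of x] by eventually_elim auto
    then show ?thesis by (intro that[of "\<lambda>k. - (real k + 1)" "\<lambda>k. real k + 1"]) (auto simp: 1)
  next
    case (2 a)
    have "\<forall>\<^sub>F k in sequentially. x \<in> {a..a + (real k + 1)}" if "x \<in> T" for x
      using ev[of "x - a"] by eventually_elim (use that 2 in auto)
    then show ?thesis by (intro that[of "\<lambda>k. a" "\<lambda>k. a + (real k + 1)"]) (auto simp: 2)
  next
    case (3 a)
    have "\<forall>\<^sub>F k in sequentially. x \<in> {a - (real k + 1)..a}" if "x \<in> T" for x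
      using ev[of "a - x"] by eventually_elim (use that 3 in auto)
    then show ?thesis by (intro that[of "\<lambda>k. a - (real k + 1)" "\<lambda>k. a"]) (auto simp: 3)
  next
    case (4 a b)
    then show ?thesis by (intro that[of "\<lambda>k. a" "\<lambda>k. b"]) auto
  qed
qed

text \<open>The closed interval containing all values bounds the support from outside,
  \<open>pos\<close> fills it from inside, and boundedness gives the first moment.\<close>

lemma prob_on_star_distr:
  assumes M: "prob_space M" and X [measurable]: "X \<in> borel_measurable M"
    and ab: "a < b" and T: "{a..b} \<subseteq> T" "T \<in> sets borel" and Xab: "\<And>\<omega>. X \<omega> \<in> {a..b}"
    and pos: "\<And>y e. y \<in> {a..b} \<Longrightarrow> e > 0 \<Longrightarrow> emeasure M {\<omega> \<in> space M. X \<omega> \<in> ball y e} > 0"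
  shows "prob_on_star T (distr M borel X)" and "prob_on_1 T (distr M borel X)"
proof -
  interpret prob_space M by (rule M)
  have "emeasure (distr M borel X) T = emeasure M (space M)"
  proof -
    have "X -` T \<inter> space M = space M" using T(1) Xab by blast
    then show ?thesis using T(2) by (simp add: emeasure_distr)
  qed
  then have 1: "prob_on T (distr M borel X)"
    by (simp add: prob_on_def prob_space_distr emeasure_space_1)
  have ball: "emeasure (distr M borel X) (ball y e) = emeasure M {\<omega> \<in> space M. X \<omega> \<in> ball y e}" for y e
    by (subst emeasure_distr) (auto intro!: arg_cong[where f="emeasure M"])
  have "y \<notin> msupport (distr M borel X)" if y: "y \<notin> {a..b}" for y
  proof -
    obtain e where e: "e > 0" "ball y e \<subseteq> - {a..b}"
      using openE[OF open_Compl[OF closed_atLeastAtMost], of y a b] y by (metis ComplI)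
    then have "{\<omega> \<in> space M. X \<omega> \<in> ball y e} = {}" using Xab by blast
    then have "emeasure (distr M borel X) (ball y e) = 0" by (simp only: ball emeasure_empty)
    with e(1) show ?thesis by (auto simp: msupport_def)
  qed
  moreover have "y \<in> msupport (distr M borel X)" if "y \<in> {a..b}" for y
    using pos[OF that] by (simp add: msupport_def ball del: mem_ball)
  ultimately have "msupport (distr M borel X) = {a..b}" by blast
  with 1 ab show "prob_on_star T (distr M borel X)" by (auto simp: prob_on_star_def)
  have "integrable M X"
  proof (rule integrable_const_bound)
    have "norm (X \<omega>) \<le> max \<bar>a\<bar> \<bar>b\<bar>" for \<omega> using Xab[of \<omega>] by auto
    then show "AE \<omega> in M. norm (X \<omega>) \<le> max \<bar>a\<bar> \<bar>b\<bar>" by simp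
  qed measurable
  with 1 show "prob_on_1 T (distr M borel X)"
    by (simp add: prob_on_1_def integrable_distr_eq)
qed

text \<open>The approximants live on the product of \<open>G\<close> with a uniform variable on the
  unit interval, which both decides when to mix and, rescaled, supplies the uniform value. On this
  common space they converge almost surely to the first coordinate.\<close>

lemma prob_on_star_dense:
  assumes T: "admissible_Theta T" and G: "prob_on T G"
  obtains H where "\<And>k. prob_on_star T (H k)" "\<And>k. prob_on_1 T (H k)"
    "limitin (weak_top T) H G sequentially"
proof -
  interpret G: prob_space G using G by (simp add: prob_on_def)
  have sets_G [measurable_cong]: "sets G = sets borel" using G by (simp add: prob_on_def)
  have space_G: "space G = UNIV" using sets_eq_imp_space_eq[OF sets_G] by simp
  define U where "U = uniform_measure lborel {0<..<1::real}"
  interpret U: prob_space U unfolding U_def by (rule prob_space_uniform_measure) auto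
  have sets_U [measurable_cong]: "sets U = sets borel" by (simp add: U_def)
  have space_U: "space U = UNIV" using sets_eq_imp_space_eq[OF sets_U] by simp
  interpret P: pair_prob_space G U ..
  obtain \<alpha> \<beta> :: "nat \<Rightarrow> real" where \<alpha>\<beta>: "\<And>k. \<alpha> k < \<beta> k" "\<And>k. {\<alpha> k..\<beta> k} \<subseteq> T"
    and ev: "\<And>x. x \<in> T \<Longrightarrow> \<forall>\<^sub>F k in sequentially. x \<in> {\<alpha> k..\<beta> k}"
    using admissible_Theta_exhaustion[OF T] by blast
  \<comment> \<open>With probability \<open>1 / (k + 1)\<close>, \<open>u\<close> is spread uniformly over \<open>{\<alpha> k..\<beta> k}\<close>, which forces full support.\<close>
  define X where "X k = (\<lambda>(x, u). max (\<alpha> k) (min (\<beta> k)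
    (if 0 < u \<and> u < 1 / (real k + 1) then \<alpha> k + (\<beta> k - \<alpha> k) * ((real k + 1) * u) else x)))"
    for k :: nat
  have X [measurable]: "X k \<in> borel_measurable (G \<Otimes>\<^sub>M U)" for k
    unfolding X_def by measurable
  have X_in: "X k \<omega> \<in> {\<alpha> k..\<beta> k}" for k \<omega>
    using \<alpha>\<beta>(1)[of k] by (auto simp: X_def split: prod.split)
  have [measurable]: "T \<in> sets borel" using closed_admissible_Theta[OF T] by (rule borel_closed)
  have AE_T: "AE \<omega> in G \<Otimes>\<^sub>M U. fst \<omega> \<in> T"
  proof -
    have "AE x in distr (G \<Otimes>\<^sub>M U) G fst. x \<in> T"
      unfolding U.distr_pair_fst using G
      by (intro G.AE_prob_1) (simp add: prob_on_def measure_def)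
    then show ?thesis by (subst (asm) AE_distr_iff) (auto simp: sets_G)
  qed
  have lim: "(\<lambda>k. X k \<omega>) \<longlonglongrightarrow> fst \<omega>" if \<omega>: "fst \<omega> \<in> T" for \<omega>
  proof (rule tendsto_eventually)
    obtain x u where xu: "\<omega> = (x, u)" by (cases \<omega>)
    \<comment> \<open>For fixed \<open>u\<close> the mixing eventually stops, and once the interval
      contains \<open>x\<close> the clamping is inactive: the sequence is eventually
      constant.\<close>
    have "\<forall>\<^sub>F k in sequentially. \<not> (0 < u \<and> u < 1 / (real k + 1))"
    proof (cases "0 < u")
      case True
      then have "\<forall>\<^sub>F k in sequentially. 1 / (real k + 1) < u" by real_asymp
      then show ?thesis by eventually_elim auto
    qed simp
    then show "\<forall>\<^sub>F k in sequentially. X k \<omega> = fst \<omega>"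
      using ev[OF \<omega>] by eventually_elim (auto simp: X_def xu)
  qed
  have pos: "emeasure (G \<Otimes>\<^sub>M U) {\<omega> \<in> space (G \<Otimes>\<^sub>M U). X k \<omega> \<in> ball y e} > 0"
    if y: "y \<in> {\<alpha> k..\<beta> k}" and e: "e > 0" for y e k
  proof -
    define c where "c = (\<beta> k - \<alpha> k) * (real k + 1)"
    have c: "c > 0" using \<alpha>\<beta>(1)[of k] by (simp add: c_def)
    \<comment> \<open>For \<open>u\<close> between \<open>p\<close> and \<open>q\<close>, mixing
      takes place and the uniform value \<open>\<alpha> k + c * u\<close> is within \<open>e\<close>
      of \<open>y\<close>.\<close>
    define p where "p = max 0 ((y - e - \<alpha> k) / c)"
    define q where "q = min (1 / (real k + 1)) ((y + e - \<alpha> k) / c)"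
    have "(y - e - \<alpha> k) / c < (y + e - \<alpha> k) / c" "0 < (y + e - \<alpha> k) / c"
      using c y e by (auto simp: divide_strict_right_mono)
    moreover have "(y - e - \<alpha> k) / c < 1 / (real k + 1)"
    proof -
      have "(y - e - \<alpha> k) / c < (\<beta> k - \<alpha> k) / c"
        using c y e by (intro divide_strict_right_mono) auto
      also have "\<dots> = 1 / (real k + 1)" using \<alpha>\<beta>(1)[of k] by (simp add: c_def)
      finally show ?thesis .
    qed
    ultimately have pq: "p < q" by (auto simp: p_def q_def)
    have q1: "q \<le> 1" "0 \<le> p" by (auto simp: q_def p_def min_le_iff_disj)
    have "X k (x, u) \<in> ball y e" if u: "u \<in> {p<..<q}" for x u
    proof -
      have "0 < u" "u < 1 / (real k + 1)" "(y - e - \<alpha> k) / c < u" "u < (y + e - \<alpha> k) / c"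
        using u by (auto simp: p_def q_def)
      moreover from this have "y - e < \<alpha> k + c * u" "\<alpha> k + c * u < y + e"
        using c by (auto simp: field_simps)
      moreover have "\<alpha> k + (\<beta> k - \<alpha> k) * ((real k + 1) * u) = \<alpha> k + c * u" by (simp add: c_def)
      ultimately show ?thesis using y e by (auto simp: X_def dist_real_def abs_less_iff)
    qed
    then have sub: "UNIV \<times> {p<..<q} \<subseteq> {\<omega> \<in> space (G \<Otimes>\<^sub>M U). X k \<omega> \<in> ball y e}"
      by (auto simp: space_pair_measure space_G space_U simp del: mem_ball)
    have "{0<..<1} \<inter> {p<..<q} = {p<..<q}" using q1 by auto
    then have "emeasure U {p<..<q} = ennreal (q - p)"
      using pq divide_ennreal[of "q - p" 1] by (simp add: U_def)
    then have "0 < emeasure G UNIV * emeasure U {p<..<q}"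
      using pq G.emeasure_space_1 by (simp add: space_G)
    also have "\<dots> = emeasure (G \<Otimes>\<^sub>M U) (UNIV \<times> {p<..<q})"
      by (rule U.emeasure_pair_measure_Times[symmetric]) (auto simp: sets_G sets_U)
    also have "\<dots> \<le> emeasure (G \<Otimes>\<^sub>M U) {\<omega> \<in> space (G \<Otimes>\<^sub>M U). X k \<omega> \<in> ball y e}"
    proof (rule emeasure_mono[OF sub])
      show "{\<omega> \<in> space (G \<Otimes>\<^sub>M U). X k \<omega> \<in> ball y e} \<in> sets (G \<Otimes>\<^sub>M U)"
        using measurable_sets[OF X, of "ball y e" k] by (simp add: vimage_def Int_def conj_commute del: mem_ball)
    qed
    finally show ?thesis .
  qed
  show thesis
  proof
    show "prob_on_star T (distr (G \<Otimes>\<^sub>M U) borel (X k))" "prob_on_1 T (distr (G \<Otimes>\<^sub>M U) borel (X k))" for k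
      by (rule prob_on_star_distr[OF P.prob_space_axioms X \<alpha>\<beta> \<open>T \<in> sets borel\<close> X_in pos]; assumption)+
    have "limitin (weak_top T) (\<lambda>k. distr (G \<Otimes>\<^sub>M U) borel (X k)) (distr (G \<Otimes>\<^sub>M U) borel fst) sequentially"
    proof (rule limitin_weak_top_distr)
      show "AE \<omega> in G \<Otimes>\<^sub>M U. (\<lambda>k. X k \<omega>) \<longlonglongrightarrow> fst \<omega>"
        using AE_T by eventually_elim (rule lim)
      show "X k \<omega> \<in> T" for k \<omega> using X_in \<alpha>\<beta>(2) by blast
    qed (use AE_T closed_admissible_Theta[OF T] P.prob_space_axioms in auto)
    also have "distr (G \<Otimes>\<^sub>M U) borel fst = distr (G \<Otimes>\<^sub>M U) G fst"
      by (rule distr_cong) (simp_all add: sets_G)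
    also have "\<dots> = G" by (rule U.distr_pair_fst)
    finally show "limitin (weak_top T) (\<lambda>k. distr (G \<Otimes>\<^sub>M U) borel (X k)) G sequentially" .
  qed
qed

section \<open>Conclusion\<close>

lemma ex_sba_approx_mem:
  assumes T: "admissible_Theta T" "prob_on_star T G" and U: "openin (weak_top T) U" "G \<in> U"
  shows "\<exists>n\<ge>1. sba_approx T G n \<in> U"
proof -
  have "\<forall>\<^sub>F n in sequentially. sba_approx T G n \<in> U"
    using limitin_sba_approx_prob_on_star[OF T] U by (simp add: limitin_def)
  then obtain N where "\<And>n. n \<ge> N \<Longrightarrow> sba_approx T G n \<in> U"
    by (auto simp: eventually_sequentially)
  then show ?thesis by (intro exI[of _ "max 1 N"]) auto
qed

theorem theorem2:
  fixes T :: "real set" and G0 :: "real measure"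
  assumes "admissible_Theta T"
    and "prob_on_1 T G0"
  shows "(\<forall>V. (\<exists>U. openin (weak_top T) U \<and> G0 \<in> U \<and> U \<subseteq> V) \<longrightarrow>
            (\<exists>G n. prob_on_1 T G \<and> n \<ge> 1 \<and> sba_approx T G n \<in> V))
       \<and> (prob_on_star T G0 \<longrightarrow>
            (\<forall>V. (\<exists>U. openin (weak_top T) U \<and> G0 \<in> U \<and> U \<subseteq> V) \<longrightarrow>
                 (\<exists>n\<ge>1. sba_approx T G0 n \<in> V))
            \<and> limitin (weak_top T) (\<lambda>n. sba_approx T G0 n) G0 sequentially)"
proof (intro conjI allI impI)
  fix V assume "\<exists>U. openin (weak_top T) U \<and> G0 \<in> U \<and> U \<subseteq> V"
  then obtain U where U: "openin (weak_top T) U" "G0 \<in> U" "U \<subseteq> V" by blast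
  have "prob_on T G0" using assms(2) by (simp add: prob_on_1_def)
  \<comment> \<open>Density puts some \<open>H k\<close> into the open set \<open>U\<close>; the
    approximations of \<open>H k\<close> converge to it and so enter the same
    \<open>U\<close>.\<close>
  then obtain H where H: "\<And>k. prob_on_star T (H k)" "\<And>k. prob_on_1 T (H k)"
    "limitin (weak_top T) H G0 sequentially"
    using prob_on_star_dense[OF assms(1)] by blast
  have "\<forall>\<^sub>F k in sequentially. H k \<in> U"
    using H(3) U(1,2) by (simp add: limitin_def)
  then obtain k where "H k \<in> U" by (auto simp: eventually_sequentially)
  then show "\<exists>G n. prob_on_1 T G \<and> n \<ge> 1 \<and> sba_approx T G n \<in> V"
    using ex_sba_approx_mem[OF assms(1) H(1) U(1)] H(2) U(3) by blast
next
  fix V assume "prob_on_star T G0" "\<exists>U. openin (weak_top T) U \<and> G0 \<in> U \<and> U \<subseteq> V"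
  then show "\<exists>n\<ge>1. sba_approx T G0 n \<in> V"
    using ex_sba_approx_mem[OF assms(1)] by blast
next
  assume "prob_on_star T G0"
  then show "limitin (weak_top T) (\<lambda>n. sba_approx T G0 n) G0 sequentially"
    by (rule limitin_sba_approx_prob_on_star[OF assms(1)])
qed

end
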